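(* Let $n\ge2$ and let $u,v\in\mathbb{M}_n(\mathbb{C})$ be unitary matrices. Then $$\alpha\left(u\Delta^{(n)}u^*,v\Delta^{(n)}v^*\right)=\frac{\pi}{2}\iff u^*v\text{ is a Hadamard unitary}.$$
   Context: $\Delta^{(n)}$ denotes the algebra of diagonal matrices in $\mathbb{M}_n(\mathbb{C})$. A Hadamard unitary in $\mathbb{M}_n(\mathbb{C})$ is a unitary $W$ with $|W_{ij}|=1/\sqrt n$ for all $i,j$ (equivalently, $\sqrt n\,W$ is a complex Hadamard matrix). Interior angle (taken with respect to $E_0(X)=\frac1n\operatorname{Tr}(X)\mathbb{I}_n$): view $\mathbb{M}_n(\mathbb{C})$ as a Hilbert space with inner product $\langle X,Y\rangle_\tau=\frac1n\operatorname{Tr}(X^*Y)$, and let $\mathbb{M}_n(\mathbb{C})$ act on it by left multiplication. For a unital $C^*$-subalgebra $\mathcal{C}\subseteq\mathbb{M}_n(\mathbb{C})$ let $e_{\mathcal{C}}\in\mathcal{B}(\mathbb{M}_n(\mathbb{C}))$ be the Jones projection $X\mapsto E_{\mathcal{C}}(X)$, where $E_{\mathcal{C}}$ is the trace-preserving conditional expectation onto $\mathcal{C}$ (equivalently, $e_{\mathcal{C}}$ is the orthogonal projection onto $\mathcal{C}$), and let $e_1:=e_{\mathbb{C}\mathbb{I}_n}$. Let $\tilde{E}:\mathcal{B}(\mathbb{M}_n(\mathbb{C}))\to\mathbb{M}_n(\mathbb{C})$ be the dual conditional expectation, i.e. the linear map determined by $\tilde{E}(xe_1y)=\frac1{n^2}xy$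 for $x,y\in\mathbb{M}_n(\mathbb{C})$. (Identifying $A\otimes B$ with the operator $X\mapsto AXB^T$, one has $\tilde{E}(A\otimes B)=\frac1n\operatorname{Tr}(B)A$.) For $S,T\in\mathcal{B}(\mathbb{M}_n(\mathbb{C}))$ put $\langle S,T\rangle:=\tilde{E}(S^*T)$ and $\|S\|_{\sim}:=\|\tilde{E}(S^*S)\|^{1/2}$, with the operator norm on $\mathbb{M}_n(\mathbb{C})$. For unital $C^*$-subalgebras $\mathcal{C},\mathcal{D}\neq\mathbb{C}\mathbb{I}_n$, $\alpha(\mathcal{C},\mathcal{D})$ is the unique element of $[0,\pi/2]$ with $$\cos\alpha(\mathcal{C},\mathcal{D})=\frac{\|\langle e_{\mathcal{C}}-e_1,\,e_{\mathcal{D}}-e_1\rangle\|}{\|e_{\mathcal{C}}-e_1\|_{\sim}\,\|e_{\mathcal{D}}-e_1\|_{\sim}}.$$ *)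

theory Defs
  imports "HOL-Analysis.Analysis"
begin

type_synonym 'n cmat = "complex ^ 'n ^ 'n"

section \<open>Matrices\<close>

definition adj :: "('n::finite) cmat \<Rightarrow> 'n cmat" where
  "adj A = (\<chi> i j. cnj (A $ j $ i))"

text \<open>The library's \<open>*s\<close> would take a row vector, not a complex number, as scalar here.\<close>
definition cscale :: "complex \<Rightarrow> ('n::finite) cmat \<Rightarrow> 'n cmat" (infixr "*\<^sub>C" 75) where
  "c *\<^sub>C A = (\<chi> i j. c * A $ i $ j)"

definition unitary :: "('n::finite) cmat \<Rightarrow> bool" where
  "unitary U \<longleftrightarrow> adj U ** U = mat 1 \<and> U ** adj U = mat 1"

definition hadamard_unitary :: "('n::finite) cmat \<Rightarrow> bool" where
  "hadamard_unitary W \<longleftrightarrow> unitary W \<and> (\<forall>i j. cmod (W $ i $ j) = 1 / sqrt (real CARD('n)))"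

definition diagonals :: "('n::finite) cmat set" where
  "diagonals = {A. \<forall>i j. i \<noteq> j \<longrightarrow> A $ i $ j = 0}"

definition scalars :: "('n::finite) cmat set" where
  "scalars = range (\<lambda>c. c *\<^sub>C mat 1)"

definition conj_set :: "('n::finite) cmat \<Rightarrow> 'n cmat set \<Rightarrow> 'n cmat set" where
  "conj_set U S = (\<lambda>A. U ** A ** adj U) ` S"

text \<open>The norm on \<open>complex ^ 'n\<close> is the Euclidean one, so this is the C*-norm.\<close>
definition mat_opnorm :: "('n::finite) cmat \<Rightarrow> real" where
  "mat_opnorm A = onorm (\<lambda>x. A *v x)"

text \<open>Subspaces of a finite-dimensional space are closed, so no topological condition is needed.\<close>
definition unital_cstar_subalgebra :: "('n::finite) cmat set \<Rightarrow> bool" where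
  "unital_cstar_subalgebra C \<longleftrightarrow>
     mat 1 \<in> C \<and>
     (\<forall>A\<in>C. \<forall>B\<in>C. A + B \<in> C \<and> A ** B \<in> C) \<and>
     (\<forall>c. \<forall>A\<in>C. c *\<^sub>C A \<in> C) \<and>
     (\<forall>A\<in>C. adj A \<in> C)"

section \<open>Operators on the Hilbert space of matrices\<close>

definition inner_tau :: "('n::finite) cmat \<Rightarrow> 'n cmat \<Rightarrow> complex" where
  "inner_tau X Y = trace (adj X ** Y) / of_nat CARD('n)"

text \<open>Membership in \<open>B(M\<^sub>n(\<complex>))\<close>; boundedness is automatic.\<close>
definition op_clinear :: "(('n::finite) cmat \<Rightarrow> 'n cmat) \<Rightarrow> bool" where
  "op_clinear S \<longleftrightarrow>
     (\<forall>X Y. S (X + Y) = S X + S Y) \<and> (\<forall>c X. S (c *\<^sub>C X) = c *\<^sub>C S X)"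

text \<open>HOL's \<open>adjoint\<close> refers to the real inner product; this is the adjoint for \<open>inner_tau\<close>.\<close>
definition op_adj :: "(('n::finite) cmat \<Rightarrow> 'n cmat) \<Rightarrow> ('n cmat \<Rightarrow> 'n cmat)" where
  "op_adj S = (THE T. \<forall>X Y. inner_tau (T X) Y = inner_tau X (S Y))"

text \<open>Positive elements of \<open>M\<^sub>n(\<complex>)\<close> are those of the form \<open>adj Y ** Y\<close>.\<close>
definition is_trace_cond_exp :: "('n::finite) cmat set \<Rightarrow> ('n cmat \<Rightarrow> 'n cmat) \<Rightarrow> bool" where
  "is_trace_cond_exp C E \<longleftrightarrow>
     op_clinear E \<and>
     (\<forall>X. E X \<in> C) \<and>
     (\<forall>A\<in>C. E A = A) \<and>
     (\<forall>A\<in>C. \<forall>B\<in>C. \<forall>X. E (A ** X ** B) = A ** E X ** B) \<and>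
     (\<forall>X. \<exists>Y. E (adj X ** X) = adj Y ** Y) \<and>
     (\<forall>X. trace (E X) = trace X)"

text \<open>
  As an operator on \<open>M\<^sub>n(\<complex>)\<close>, the Jones projection \<open>e\<^sub>C\<close> is the
  trace-preserving conditional expectation itself.
\<close>
definition jones :: "('n::finite) cmat set \<Rightarrow> ('n cmat \<Rightarrow> 'n cmat)" where
  "jones C = (THE E. is_trace_cond_exp C E)"

abbreviation e1 :: "('n::finite) cmat \<Rightarrow> 'n cmat" where
  "e1 \<equiv> jones scalars"

text \<open>
  Matrices act by left multiplication, so \<open>x e\<^sub>1 y\<close> is \<open>\<lambda>X. x ** e1 (y ** X)\<close>.
  The last conjunct only fixes the irrelevant values outside \<open>B(M\<^sub>n(\<complex>))\<close>.
\<close>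
definition is_dual_cond_exp :: "((('n::finite) cmat \<Rightarrow> 'n cmat) \<Rightarrow> 'n cmat) \<Rightarrow> bool" where
  "is_dual_cond_exp E \<longleftrightarrow>
     (\<forall>S T. op_clinear S \<longrightarrow> op_clinear T \<longrightarrow> E (\<lambda>X. S X + T X) = E S + E T) \<and>
     (\<forall>c S. op_clinear S \<longrightarrow> E (\<lambda>X. c *\<^sub>C S X) = c *\<^sub>C E S) \<and>
     (\<forall>x y. E (\<lambda>X. x ** e1 (y ** X)) = (1 / (of_nat CARD('n))\<^sup>2) *\<^sub>C (x ** y)) \<and>
     (\<forall>S. \<not> op_clinear S \<longrightarrow> E S = 0)"

definition dual_cond_exp :: "(('n::finite) cmat \<Rightarrow> 'n cmat) \<Rightarrow> 'n cmat" where
  "dual_cond_exp = (THE E. is_dual_cond_exp E)"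

section \<open>The interior angle\<close>

definition op_inner ::
  "(('n::finite) cmat \<Rightarrow> 'n cmat) \<Rightarrow> ('n cmat \<Rightarrow> 'n cmat) \<Rightarrow> 'n cmat" where
  "op_inner S T = dual_cond_exp (op_adj S \<circ> T)"

definition op_norm :: "(('n::finite) cmat \<Rightarrow> 'n cmat) \<Rightarrow> real" where
  "op_norm S = sqrt (mat_opnorm (dual_cond_exp (op_adj S \<circ> S)))"

definition reduced_jones :: "('n::finite) cmat set \<Rightarrow> ('n cmat \<Rightarrow> 'n cmat)" where
  "reduced_jones C = (\<lambda>X. jones C X - e1 X)"

text \<open>
  Only meaningful for unital C*-subalgebras other than \<open>scalars\<close>;
  for \<open>C = scalars\<close> the denominator is zero.
\<close>
definition interior_angle :: "('n::finite) cmat set \<Rightarrow> 'n cmat set \<Rightarrow> real" where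
  "interior_angle C D = (THE \<alpha>. \<alpha> \<in> {0..pi/2} \<and>
     cos \<alpha> = mat_opnorm (op_inner (reduced_jones C) (reduced_jones D)) /
             (op_norm (reduced_jones C) * op_norm (reduced_jones D)))"

section \<open>Well-definedness\<close>

lemma matrix_mul_nth: "(A ** B) $ i $ j = (\<Sum>k\<in>UNIV. A $ i $ k * B $ k $ j)"
  by (simp add: matrix_matrix_mult_def)

lemma adj_adj [simp]: "adj (adj A) = A"
  by (simp add: adj_def vec_eq_iff)

lemma adj_mult: "adj (A ** B) = adj B ** adj A"
  by (simp add: adj_def vec_eq_iff matrix_mul_nth mult.commute)

lemma cscale_mult_left [simp]: "(c *\<^sub>C A) ** B = c *\<^sub>C (A ** B)"
  by (simp add: cscale_def vec_eq_iff matrix_mul_nth sum_distrib_left mult.assoc)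

lemma cscale_mult_right [simp]: "A ** (c *\<^sub>C B) = c *\<^sub>C (A ** B)"
  by (simp add: cscale_def vec_eq_iff matrix_mul_nth sum_distrib_left algebra_simps)

lemma cmat_add_rdistrib: "((A + B) :: ('n::finite) cmat) ** C = A ** C + B ** C"
  by (simp add: vec_eq_iff matrix_mul_nth algebra_simps sum.distrib)

lemma cmat_mult_sum: "A ** (\<Sum>i\<in>I. f i :: ('n::finite) cmat) = (\<Sum>i\<in>I. A ** f i)"
proof -
  have 0: "A ** (0 :: 'n cmat) = 0"
    by (simp add: vec_eq_iff matrix_mul_nth)
  show ?thesis
    by (induction I rule: infinite_finite_induct) (simp_all add: 0 matrix_add_ldistrib)
qed

lemma cscale_add: "c *\<^sub>C (A + B) = c *\<^sub>C A + c *\<^sub>C B"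
  by (simp add: cscale_def vec_eq_iff algebra_simps)

lemma cscale_cscale [simp]: "c *\<^sub>C (d *\<^sub>C A) = (c * d) *\<^sub>C A"
  by (simp add: cscale_def vec_eq_iff algebra_simps)

lemma cscale_one [simp]: "1 *\<^sub>C A = A"
  by (simp add: cscale_def vec_eq_iff)

lemma cscale_sum: "c *\<^sub>C (\<Sum>i\<in>I. f i) = (\<Sum>i\<in>I. c *\<^sub>C f i)"
  by (simp add: cscale_def vec_eq_iff sum_distrib_left)

lemma trace_cscale [simp]: "trace (c *\<^sub>C A) = c * trace A"
  by (simp add: cscale_def trace_def sum_distrib_left)

lemma trace_adj_self: "trace (adj A ** A) = of_real (\<Sum>i\<in>UNIV. \<Sum>k\<in>UNIV. (cmod (A $ k $ i))\<^sup>2)"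
  unfolding trace_def adj_def matrix_mul_nth of_real_sum
  by (intro sum.cong refl) (subst complex_norm_square, simp add: mult.commute)

lemma trace_adj_self_eq_0: "trace (adj A ** A) = 0 \<longleftrightarrow> A = 0"
proof
  assume "trace (adj A ** A) = 0"
  then have "(\<Sum>i\<in>UNIV. \<Sum>k\<in>UNIV. (cmod (A $ k $ i))\<^sup>2) = 0"
    by (metis of_real_eq_0_iff trace_adj_self)
  then have "A $ k $ i = 0" for k i
    by (subst (asm) sum_nonneg_eq_0_iff; auto simp: sum_nonneg sum_nonneg_eq_0_iff)
  then show "A = 0" by (simp add: vec_eq_iff)
qed (simp add: trace_def matrix_mul_nth)

lemma unital_cstar_subalgebra_conj_diagonals:
  assumes "unitary U"
  shows "unital_cstar_subalgebra (conj_set U diagonals)"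
proof -
  have U: "adj U ** U = mat 1" "U ** adj U = mat 1"
    using assms by (auto simp: unitary_def)
  have diag_mult: "A ** B \<in> diagonals" if "A \<in> diagonals" "B \<in> diagonals" for A B :: "'a cmat"
  proof -
    have "A $ i $ k * B $ k $ j = 0" if "i \<noteq> j" for i j k
      using that \<open>A \<in> diagonals\<close> \<open>B \<in> diagonals\<close> unfolding diagonals_def
      by (cases "i = k") auto
    then show ?thesis
      by (auto simp: diagonals_def matrix_mul_nth intro!: sum.neutral)
  qed
  have "mat 1 \<in> conj_set U diagonals"
    unfolding conj_set_def
    by (rule image_eqI[of _ _ "mat 1"]) (simp_all add: U diagonals_def, simp add: mat_def)
  moreover have "A + B \<in> conj_set U diagonals" "A ** B \<in> conj_set U diagonals"
    if AB: "A \<in> conj_set U diagonals" "B \<in> conj_set U diagonals" for A B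
  proof -
    obtain a b where ab: "A = U ** a ** adj U" "B = U ** b ** adj U"
        "a \<in> diagonals" "b \<in> diagonals"
      using AB by (auto simp: conj_set_def)
    have "a + b \<in> diagonals" using ab by (simp add: diagonals_def)
    moreover have "A + B = U ** (a + b) ** adj U"
      by (simp add: ab matrix_add_ldistrib cmat_add_rdistrib)
    ultimately show "A + B \<in> conj_set U diagonals"
      unfolding conj_set_def by (rule image_eqI[rotated])
    have "A ** B = U ** a ** (adj U ** U) ** b ** adj U"
      unfolding ab by (simp only: matrix_mul_assoc)
    also have "\<dots> = U ** (a ** b) ** adj U"
      by (simp add: U matrix_mul_assoc)
    finally show "A ** B \<in> conj_set U diagonals"
      unfolding conj_set_def by (rule image_eqI) (intro diag_mult ab)
  qed
  moreover have "c *\<^sub>C A \<in> conj_set U diagonals" "adj A \<in> conj_set U diagonals"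
    if A: "A \<in> conj_set U diagonals" for c A
  proof -
    obtain a where a: "A = U ** a ** adj U" "a \<in> diagonals"
      using A by (auto simp: conj_set_def)
    have "c *\<^sub>C a \<in> diagonals" "adj a \<in> diagonals"
      using a by (auto simp: diagonals_def cscale_def adj_def)
    moreover have "c *\<^sub>C A = U ** (c *\<^sub>C a) ** adj U" "adj A = U ** adj a ** adj U"
      by (simp_all add: a adj_mult matrix_mul_assoc)
    ultimately show "c *\<^sub>C A \<in> conj_set U diagonals" "adj A \<in> conj_set U diagonals"
      unfolding conj_set_def by (metis image_eqI)+
  qed
  ultimately show ?thesis
    unfolding unital_cstar_subalgebra_def by (intro conjI ballI allI)
qed

lemma conj_diagonals_neq_scalars:
  fixes U :: "('n::finite) cmat"
  assumes "unitary U" "CARD('n) \<ge> 2"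
  shows "conj_set U diagonals \<noteq> scalars"
proof
  assume eq: "conj_set U diagonals = scalars"
  have U: "adj U ** U = mat 1"
    using assms by (auto simp: unitary_def)
  obtain a b :: 'n where "a \<noteq> b"
    using assms(2) card_le_Suc0_iff_eq[of "UNIV :: 'n set"] by force
  define d :: "'n cmat" where "d = (\<chi> i j. if i = a \<and> j = a then 1 else 0)"
  have "U ** d ** adj U \<in> conj_set U diagonals"
    unfolding conj_set_def by (rule imageI) (auto simp: diagonals_def d_def)
  then obtain c where "U ** d ** adj U = c *\<^sub>C mat 1"
    using eq by (auto simp: scalars_def)
  then have "adj U ** (U ** d ** adj U) ** U = c *\<^sub>C mat 1"
    by (simp add: U)
  moreover have "adj U ** (U ** d ** adj U) ** U = (adj U ** U) ** d ** (adj U ** U)"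
    by (simp only: matrix_mul_assoc)
  ultimately have "d = c *\<^sub>C mat 1" by (simp add: U)
  then have "d $ a $ a = d $ b $ b"
    by (simp add: cscale_def mat_def)
  then show False using \<open>a \<noteq> b\<close> by (simp add: d_def)
qed

lemma trace_cond_exp_unique:
  assumes C: "unital_cstar_subalgebra C"
    and E: "is_trace_cond_exp C E" and F: "is_trace_cond_exp C F"
  shows "E = F"
proof
  fix X
  have one: "mat 1 \<in> C" using C by (simp add: unital_cstar_subalgebra_def)
  have tr: "trace (A ** G X) = trace (A ** X)" if "is_trace_cond_exp C G" "A \<in> C" for A G
  proof -
    have "G (A ** X ** mat 1) = A ** G X ** mat 1"
      using that one unfolding is_trace_cond_exp_def by blast
    then show ?thesis
      using that unfolding is_trace_cond_exp_def by (metis matrix_mul_rid)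
  qed
  define D where "D = E X - F X"
  have "D = E X + (-1) *\<^sub>C F X"
    by (simp add: D_def cscale_def vec_eq_iff)
  moreover have "E X \<in> C" "F X \<in> C"
    using E F by (auto simp: is_trace_cond_exp_def)
  ultimately have "adj D \<in> C"
    using C by (auto simp: unital_cstar_subalgebra_def)
  then have "trace (adj D ** E X) = trace (adj D ** F X)"
    using tr[OF E] tr[OF F] by simp
  moreover have "adj D ** D = adj D ** E X - adj D ** F X"
    by (simp add: D_def matrix_mul_nth vec_eq_iff sum_subtractf algebra_simps)
  ultimately have "trace (adj D ** D) = 0"
    by (simp add: trace_sub)
  then show "E X = F X"
    by (simp add: trace_adj_self_eq_0 D_def)
qed

lemma jones_eqI:
  assumes "unital_cstar_subalgebra C" "is_trace_cond_exp C E"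
  shows "jones C = E"
  unfolding jones_def by (rule the_equality) (fact assms(2), rule trace_cond_exp_unique[OF assms(1) _ assms(2)])

lemma unital_cstar_subalgebra_scalars:
  "unital_cstar_subalgebra (scalars :: ('n::finite) cmat set)"
proof -
  have "c *\<^sub>C (mat 1 :: 'n cmat) + d *\<^sub>C mat 1 = (c + d) *\<^sub>C mat 1" for c d
    by (simp add: cscale_def vec_eq_iff algebra_simps)
  moreover have "adj (c *\<^sub>C (mat 1 :: 'n cmat)) = cnj c *\<^sub>C mat 1" for c
    by (simp add: cscale_def vec_eq_iff adj_def mat_def)
  moreover have "(mat 1 :: 'n cmat) \<in> scalars"
    unfolding scalars_def by (rule range_eqI[of _ _ 1]) simp
  ultimately show ?thesis
    unfolding unital_cstar_subalgebra_def by (auto simp: scalars_def)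
qed

lemma e1_eq: "e1 (X :: ('n::finite) cmat) = (trace X / of_nat CARD('n)) *\<^sub>C mat 1"
proof -
  let ?E = "\<lambda>X :: 'n cmat. (trace X / of_nat CARD('n)) *\<^sub>C (mat 1 :: 'n cmat)"
  have "?E (X + Y) = ?E X + ?E Y" for X Y
    by (simp add: trace_add cscale_def vec_eq_iff add_divide_distrib algebra_simps)
  then have lin: "op_clinear ?E"
    by (simp add: op_clinear_def)
  have tr1: "trace (mat 1 :: 'n cmat) = of_nat CARD('n)"
    by (simp add: trace_def mat_def)
  have pos: "\<exists>Y. ?E (adj X ** X) = adj Y ** Y" for X
  proof -
    define r where "r = (\<Sum>i\<in>UNIV. \<Sum>k\<in>UNIV. (cmod (X $ k $ i))\<^sup>2) / real CARD('n)"
    have "r \<ge> 0" by (simp add: r_def sum_nonneg)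
    have "adj (of_real (sqrt r) *\<^sub>C mat 1) = (of_real (sqrt r) *\<^sub>C mat 1 :: 'n cmat)"
      by (simp add: cscale_def adj_def mat_def vec_eq_iff)
    then have "adj (of_real (sqrt r) *\<^sub>C mat 1 :: 'n cmat) ** (of_real (sqrt r) *\<^sub>C mat 1)
        = of_real (sqrt r * sqrt r) *\<^sub>C mat 1"
      by (simp only: cscale_mult_left cscale_mult_right cscale_cscale matrix_mul_lid of_real_mult)
    also have "\<dots> = ?E (adj X ** X)"
      using \<open>r \<ge> 0\<close> by (simp only: trace_adj_self r_def real_sqrt_mult_self abs_of_nonneg
          of_real_divide of_real_of_nat_eq)
    finally show ?thesis by metis
  qed
  have "is_trace_cond_exp scalars ?E"
    unfolding is_trace_cond_exp_def
    using lin pos by (auto simp: scalars_def tr1 mult_ac)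
  then show ?thesis
    by (simp add: jones_eqI[OF unital_cstar_subalgebra_scalars])
qed

lemma jones_conj_diagonals:
  fixes U :: "('n::finite) cmat"
  assumes "unitary U"
  defines "p \<equiv> \<lambda>X. \<chi> i j. if i = j then X $ i $ j else 0"
  shows "jones (conj_set U diagonals) X = U ** p (adj U ** X ** U) ** adj U"
proof -
  have U: "adj U ** U = mat 1" "U ** adj U = mat 1"
    using assms by (auto simp: unitary_def)
  define E where "E = (\<lambda>X. U ** p (adj U ** X ** U) ** adj U)"
  have p_add: "p (X + Y) = p X + p Y" and p_cscale: "p (c *\<^sub>C X) = c *\<^sub>C p X" for X Y c
    by (simp_all add: p_def vec_eq_iff cscale_def)
  have p_diag: "p X \<in> diagonals" and p_id: "a \<in> diagonals \<Longrightarrow> p a = a" for X a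
    by (auto simp: p_def diagonals_def vec_eq_iff)
  have trace_p: "trace (p X) = trace X" for X
    by (simp add: p_def trace_def)
  have diag_mult: "(a ** X) $ i $ j = a $ i $ i * X $ i $ j"
      "(X ** a) $ i $ j = X $ i $ j * a $ j $ j" if "a \<in> diagonals" for a X :: "'n cmat" and i j
  proof -
    have "(a ** X) $ i $ j = (\<Sum>k\<in>UNIV. if k = i then a $ i $ i * X $ i $ j else 0)"
      unfolding matrix_mul_nth using that by (intro sum.cong) (auto simp: diagonals_def)
    moreover have "(X ** a) $ i $ j = (\<Sum>k\<in>UNIV. if k = j then X $ i $ j * a $ j $ j else 0)"
      unfolding matrix_mul_nth using that by (intro sum.cong) (auto simp: diagonals_def)
    ultimately show "(a ** X) $ i $ j = a $ i $ i * X $ i $ j"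
      "(X ** a) $ i $ j = X $ i $ j * a $ j $ j" by simp_all
  qed
  have p_bimod: "p (a ** X ** b) = a ** p X ** b"
    if "a \<in> diagonals" "b \<in> diagonals" for a b X :: "'n cmat"
    using that by (auto simp: vec_eq_iff diag_mult p_def diagonals_def)
  have cancel: "adj U ** (U ** X ** adj U) ** U = X" for X
  proof -
    have "adj U ** (U ** X ** adj U) ** U = (adj U ** U) ** X ** (adj U ** U)"
      by (simp only: matrix_mul_assoc)
    then show ?thesis by (simp add: U)
  qed
  have cut: "U ** (X ** Y) ** adj U = (U ** X ** adj U) ** (U ** Y ** adj U)" for X Y
  proof -
    have "(U ** X ** adj U) ** (U ** Y ** adj U) = U ** X ** (adj U ** U) ** Y ** adj U"
      by (simp only: matrix_mul_assoc)
    then show ?thesis by (simp add: U matrix_mul_assoc)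
  qed
  have cut': "adj U ** (X ** Y) ** U = (adj U ** X ** U) ** (adj U ** Y ** U)" for X Y
  proof -
    have "(adj U ** X ** U) ** (adj U ** Y ** U) = adj U ** X ** (U ** adj U) ** Y ** U"
      by (simp only: matrix_mul_assoc)
    then show ?thesis by (simp add: U matrix_mul_assoc)
  qed
  have lin: "op_clinear E"
    by (simp add: op_clinear_def E_def matrix_add_ldistrib cmat_add_rdistrib p_add p_cscale)
  have ran: "E X \<in> conj_set U diagonals" for X
    unfolding E_def conj_set_def by (intro imageI p_diag)
  have fixed: "E A = A" if "A \<in> conj_set U diagonals" for A
    using that by (auto simp: conj_set_def E_def cancel p_id)
  have bimod: "E (A ** X ** B) = A ** E X ** B"
    if AB: "A \<in> conj_set U diagonals" "B \<in> conj_set U diagonals" for A B X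
  proof -
    obtain a b where ab: "A = U ** a ** adj U" "B = U ** b ** adj U"
        "a \<in> diagonals" "b \<in> diagonals"
      using AB by (auto simp: conj_set_def)
    have "adj U ** (A ** X ** B) ** U = a ** (adj U ** X ** U) ** b"
      unfolding cut'[of "A ** X" B] cut'[of A X] by (simp only: ab(1,2) cancel)
    then have "E (A ** X ** B) = U ** (a ** p (adj U ** X ** U) ** b) ** adj U"
      by (simp only: E_def p_bimod[OF ab(3,4)])
    also have "\<dots> = A ** E X ** B"
      by (simp only: cut ab(1,2) E_def)
    finally show ?thesis .
  qed
  have pos: "\<exists>Y. E (adj X ** X) = adj Y ** Y" for X
  proof -
    define Z where "Z = X ** U"
    define r where "r i = (\<Sum>k\<in>UNIV. (cmod (Z $ k $ i))\<^sup>2)" for i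
    define d :: "'n cmat" where "d = (\<chi> i j. if i = j then of_real (sqrt (r i)) else 0)"
    have d: "d \<in> diagonals" "adj d = d"
      by (auto simp: d_def diagonals_def adj_def vec_eq_iff)
    have r0: "r i \<ge> 0" for i by (simp add: r_def sum_nonneg)
    have "(adj Z ** Z) $ i $ i = of_real (r i)" for i
      unfolding matrix_mul_nth r_def of_real_sum
      by (intro sum.cong refl) (simp only: adj_def vec_lambda_beta complex_norm_square mult.commute)
    moreover have "(d ** d) $ i $ j = (if i = j then of_real (r i) else 0)" for i j
      using r0[of i] r0[of j] by (simp add: diag_mult(1)[OF d(1)])
        (simp add: d_def flip: of_real_mult)
    ultimately have "p (adj Z ** Z) = d ** d"
      by (simp add: p_def vec_eq_iff)
    moreover have "adj U ** (adj X ** X) ** U = adj Z ** Z"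
      by (simp add: Z_def adj_mult matrix_mul_assoc)
    ultimately have "E (adj X ** X) = U ** (d ** d) ** adj U"
      by (simp add: E_def)
    also have "\<dots> = adj (d ** adj U) ** (d ** adj U)"
      by (simp add: adj_mult d(2) matrix_mul_assoc)
    finally show ?thesis by blast
  qed
  have tr: "trace (E X) = trace X" for X
  proof -
    have "trace (E X) = trace (adj U ** (U ** p (adj U ** X ** U)))"
      unfolding E_def by (rule trace_mul_sym)
    also have "\<dots> = trace (p (adj U ** X ** U))"
      by (simp add: U matrix_mul_assoc)
    also have "\<dots> = trace (U ** (adj U ** X))"
      unfolding trace_p by (rule trace_mul_sym)
    also have "\<dots> = trace X"
      by (simp add: U matrix_mul_assoc)
    finally show ?thesis .
  qed
  have "is_trace_cond_exp (conj_set U diagonals) E"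
    unfolding is_trace_cond_exp_def using lin ran fixed bimod pos tr by simp
  then show ?thesis
    using jones_eqI[OF unital_cstar_subalgebra_conj_diagonals[OF assms(1)]] by (simp add: E_def)
qed

lemma op_clinearD:
  assumes "op_clinear S"
  shows "S (X + Y) = S X + S Y" "S (c *\<^sub>C X) = c *\<^sub>C S X" "S 0 = 0"
    "S (\<Sum>i\<in>I. f i) = (\<Sum>i\<in>I. S (f i))"
proof -
  show *: "S (X + Y) = S X + S Y" "S (c *\<^sub>C X) = c *\<^sub>C S X" for X Y c
    using assms by (auto simp: op_clinear_def)
  show 0: "S 0 = 0"
    using *(1)[of 0 0] by simp
  show "S (\<Sum>i\<in>I. f i) = (\<Sum>i\<in>I. S (f i))"
    by (induction I rule: infinite_finite_induct) (simp_all add: 0 *)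
qed

definition mat_unit :: "'n \<Rightarrow> 'n \<Rightarrow> ('n::finite) cmat" where
  "mat_unit i j = (\<chi> k l. if k = i \<and> l = j then 1 else 0)"

lemma mat_unit_expand: "X = (\<Sum>i\<in>UNIV. \<Sum>j\<in>UNIV. X $ i $ j *\<^sub>C mat_unit i j)"
proof -
  have "(\<Sum>i\<in>UNIV. \<Sum>j\<in>UNIV. X $ i $ j *\<^sub>C mat_unit i j) $ k $ l = X $ k $ l" for k l
  proof -
    have "(\<Sum>i\<in>UNIV. \<Sum>j\<in>UNIV. X $ i $ j *\<^sub>C mat_unit i j) $ k $ l
        = (\<Sum>i\<in>UNIV. \<Sum>j\<in>UNIV. if i = k then (if j = l then X $ i $ j else 0) else 0)"
      by (auto simp: cscale_def mat_unit_def intro!: sum.cong)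
    also have "\<dots> = (\<Sum>i\<in>UNIV. if i = k then (\<Sum>j\<in>UNIV. if j = l then X $ i $ j else 0) else 0)"
      by (intro sum.cong) auto
    also have "\<dots> = X $ k $ l"
      by simp
    finally show ?thesis .
  qed
  then show ?thesis by (simp add: vec_eq_iff)
qed

lemma mult_mat_unit: "(A ** mat_unit i j) $ k $ l = (if l = j then A $ k $ i else 0)"
proof -
  have "(A ** mat_unit i j) $ k $ l
      = (\<Sum>m\<in>UNIV. if m = i then (if l = j then A $ k $ m else 0) else 0)"
    unfolding matrix_mul_nth by (intro sum.cong refl) (simp add: mat_unit_def)
  then show ?thesis by simp
qed

lemma trace_mult_mat_unit: "trace (A ** mat_unit i j) = A $ j $ i"
  by (simp add: trace_def mult_mat_unit)

lemma trace_mat_unit_mult: "trace (mat_unit j i ** X) = X $ i $ j"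
  by (metis trace_mul_sym trace_mult_mat_unit)

lemma mat_unit_sum: "(\<Sum>i\<in>UNIV. \<Sum>j\<in>UNIV. x ** (y $ j $ i *\<^sub>C mat_unit j i)) = x ** y"
proof -
  have "(\<Sum>i\<in>UNIV. \<Sum>j\<in>UNIV. x ** (y $ j $ i *\<^sub>C mat_unit j i))
      = (\<Sum>j\<in>UNIV. \<Sum>i\<in>UNIV. x ** (y $ j $ i *\<^sub>C mat_unit j i))"
    by (rule sum.swap)
  also have "\<dots> = x ** (\<Sum>j\<in>UNIV. \<Sum>i\<in>UNIV. y $ j $ i *\<^sub>C mat_unit j i)"
    by (simp only: cmat_mult_sum)
  finally show ?thesis by (simp flip: mat_unit_expand)
qed

lemma op_clinear_rank_one: "op_clinear (\<lambda>X. x ** e1 (y ** X))"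
proof -
  have "(a + b) *\<^sub>C A = a *\<^sub>C A + b *\<^sub>C A" for a b and A :: "'a cmat"
    by (simp add: cscale_def vec_eq_iff algebra_simps)
  then show ?thesis
    by (simp add: op_clinear_def e1_eq matrix_add_ldistrib trace_add add_divide_distrib)
qed

lemma is_dual_cond_exp_sum:
  assumes E: "is_dual_cond_exp E" and "\<And>i. i \<in> I \<Longrightarrow> op_clinear (S i)" "finite I"
  shows "op_clinear (\<lambda>X. \<Sum>i\<in>I. S i X) \<and> E (\<lambda>X. \<Sum>i\<in>I. S i X) = (\<Sum>i\<in>I. E (S i))"
  using \<open>finite I\<close> assms(2)
proof (induction I)
  case empty
  have lin0: "op_clinear (\<lambda>X. 0)"
    by (simp add: op_clinear_def cscale_def vec_eq_iff)
  moreover have "E (\<lambda>X. 0 + 0) = E (\<lambda>X. 0) + E (\<lambda>X. 0)"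
    using E lin0 unfolding is_dual_cond_exp_def by blast
  ultimately show ?case by simp
next
  case (insert i I)
  then have *: "op_clinear (S i)" "op_clinear (\<lambda>X. \<Sum>i\<in>I. S i X)"
    by auto
  have "op_clinear (\<lambda>X. S i X + (\<Sum>i\<in>I. S i X))"
    using * unfolding op_clinear_def by (auto simp: cscale_add algebra_simps)
  moreover have "E (\<lambda>X. S i X + (\<Sum>i\<in>I. S i X)) = E (S i) + E (\<lambda>X. \<Sum>i\<in>I. S i X)"
    using E * unfolding is_dual_cond_exp_def by blast
  ultimately show ?case using insert by simp
qed

lemma dual_cond_exp_ex1:
  "\<exists>!E :: (('n::finite) cmat \<Rightarrow> 'n cmat) \<Rightarrow> 'n cmat. is_dual_cond_exp E"
proof (rule ex_ex1I)
  define E :: "('n cmat \<Rightarrow> 'n cmat) \<Rightarrow> 'n cmat" where "E = (\<lambda>S. if op_clinear S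
    then (1 / of_nat CARD('n)) *\<^sub>C (\<Sum>i\<in>UNIV. \<Sum>j\<in>UNIV. S (mat_unit i j) ** mat_unit j i) else 0)"
  have "op_clinear (\<lambda>X. S X + T X)" "E (\<lambda>X. S X + T X) = E S + E T"
    if "op_clinear S" "op_clinear T" for S T
  proof -
    show "op_clinear (\<lambda>X. S X + T X)"
      using that by (auto simp: op_clinear_def cscale_add algebra_simps)
    then show "E (\<lambda>X. S X + T X) = E S + E T"
      using that by (simp add: E_def cmat_add_rdistrib sum.distrib cscale_add)
  qed
  moreover have "E (\<lambda>X. c *\<^sub>C S X) = c *\<^sub>C E S" if "op_clinear S" for c S
  proof -
    have "op_clinear (\<lambda>X. c *\<^sub>C S X)"
      using that by (auto simp: op_clinear_def cscale_add algebra_simps)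
    then show ?thesis
      using that by (simp add: E_def mult.commute flip: cscale_sum)
  qed
  moreover have "E (\<lambda>X. x ** e1 (y ** X)) = (1 / (of_nat CARD('n))\<^sup>2) *\<^sub>C (x ** y)" for x y
  proof -
    have "E (\<lambda>X. x ** e1 (y ** X)) = (1 / of_nat CARD('n)) *\<^sub>C (\<Sum>i\<in>UNIV. \<Sum>j\<in>UNIV.
        (1 / of_nat CARD('n)) *\<^sub>C (x ** (y $ j $ i *\<^sub>C mat_unit j i)))"
      by (simp add: E_def op_clinear_rank_one) (simp add: e1_eq trace_mult_mat_unit)
    then show ?thesis
      by (simp only: mat_unit_sum flip: cscale_sum) (simp add: power2_eq_square)
  qed
  ultimately have "is_dual_cond_exp E"
    by (simp add: is_dual_cond_exp_def E_def)
  then show "\<exists>E :: ('n cmat \<Rightarrow> 'n cmat) \<Rightarrow> 'n cmat. is_dual_cond_exp E"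
    by (rule exI[of _ E])
next
  fix E F :: "('n cmat \<Rightarrow> 'n cmat) \<Rightarrow> 'n cmat"
  assume EF: "is_dual_cond_exp E" "is_dual_cond_exp F"
  have "E S = F S" if S: "op_clinear S" for S
  proof -
    define R where "R = (\<lambda>i j X. S (mat_unit i j) ** e1 ((of_nat CARD('n) *\<^sub>C mat_unit j i) ** X))"
    have R: "op_clinear (R i j)" for i j
      unfolding R_def by (rule op_clinear_rank_one)
    have SR: "S = (\<lambda>X. \<Sum>i\<in>UNIV. \<Sum>j\<in>UNIV. R i j X)"
    proof
      fix X
      have "S X = S (\<Sum>i\<in>UNIV. \<Sum>j\<in>UNIV. X $ i $ j *\<^sub>C mat_unit i j)"
        by (simp flip: mat_unit_expand)
      also have "\<dots> = (\<Sum>i\<in>UNIV. \<Sum>j\<in>UNIV. R i j X)"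
        by (simp add: op_clinearD[OF S] R_def e1_eq trace_mat_unit_mult)
      finally show "S X = (\<Sum>i\<in>UNIV. \<Sum>j\<in>UNIV. R i j X)" .
    qed
    have expand: "G S = (\<Sum>i\<in>UNIV. \<Sum>j\<in>UNIV. G (R i j))" if G: "is_dual_cond_exp G" for G
    proof -
      have 1: "op_clinear (\<lambda>X. \<Sum>j\<in>UNIV. R i j X) \<and>
          G (\<lambda>X. \<Sum>j\<in>UNIV. R i j X) = (\<Sum>j\<in>UNIV. G (R i j))" for i
        by (rule is_dual_cond_exp_sum[OF G]) (simp_all add: R)
      then show ?thesis
        by (subst SR, subst is_dual_cond_exp_sum[OF G, THEN conjunct2]) simp_all
    qed
    have "E (R i j) = F (R i j)" for i j
      using EF unfolding R_def is_dual_cond_exp_def by metis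
    then show ?thesis by (simp add: expand EF)
  qed
  moreover have "E S = F S" if "\<not> op_clinear S" for S
    using EF that by (simp add: is_dual_cond_exp_def)
  ultimately show "E = F" by blast
qed

end

(*
  Write W = u^* v and q_k = u E_kk u^*, r_l = v E_ll v^*. The product of the two reduced Jones
  projections is X |-> sum_kl q_k r_l X r_l q_k - e_1(X), and tr(r_l q_k) = |W_kl|^2, so its dual
  conditional expectation is u M v^* / n with M_kl = (|W_kl|^2 - 1/n) W_kl. The angle is pi/2 iff
  M = 0, i.e. iff every |W_kl|^2 is 0 or 1/n, and as the rows of W are unit vectors, 0 cannot occur.
  The bound ||M|| <= 1 - 1/n, a Cauchy-Schwarz inequality, guarantees that the angle exists.
*)
theory Submission
  imports Defs
begin

section \<open>Matrix units, adjoints and traces\<close>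

lemma cmat_sum_mult: "(\<Sum>i\<in>I. f i :: ('n::finite) cmat) ** A = (\<Sum>i\<in>I. f i ** A)"
proof -
  have 0: "(0 :: 'n cmat) ** A = 0"
    by (simp add: vec_eq_iff matrix_mul_nth)
  show ?thesis
    by (induction I rule: infinite_finite_induct) (simp_all add: 0 cmat_add_rdistrib)
qed

lemma mat_unit_mult: "(mat_unit i j ** A) $ k $ l = (if k = i then A $ j $ l else 0)"
proof -
  have "(mat_unit i j ** A) $ k $ l
      = (\<Sum>m\<in>UNIV. if m = j then (if k = i then A $ m $ l else 0) else 0)"
    unfolding matrix_mul_nth by (intro sum.cong refl) (simp add: mat_unit_def)
  then show ?thesis by simp
qed

lemma mat_unit_sandwich: "mat_unit i j ** A ** mat_unit k l = A $ j $ k *\<^sub>C mat_unit i l"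
  by (simp add: vec_eq_iff mult_mat_unit mat_unit_mult)
    (auto simp: cscale_def mat_unit_def)

lemma sum_mat_unit_diag: "(\<Sum>i\<in>UNIV. mat_unit i i) = mat 1"
  by (auto simp: vec_eq_iff mat_unit_def mat_def intro!: sum.neutral)

lemma adj_cscale: "adj (c *\<^sub>C A) = cnj c *\<^sub>C adj A"
  by (simp add: adj_def cscale_def vec_eq_iff)

lemma adj_sum: "adj (\<Sum>i\<in>I. f i) = (\<Sum>i\<in>I. adj (f i))"
  by (simp add: adj_def vec_eq_iff)

lemma adj_diff: "adj (A - B) = adj A - adj B"
  by (simp add: adj_def vec_eq_iff)

lemma adj_mat_unit: "adj (mat_unit i j) = mat_unit j i"
  by (auto simp: adj_def mat_unit_def vec_eq_iff)

lemma trace_adj: "trace (adj A) = cnj (trace A)"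
  by (simp add: trace_def adj_def)

lemma trace_sum: "trace (\<Sum>i\<in>I. f i :: ('n::finite) cmat) = (\<Sum>i\<in>I. trace (f i))"
  unfolding trace_def by (subst sum.swap) simp

lemma cmat_diff_rdistrib: "((A - B) :: ('n::finite) cmat) ** C = A ** C - B ** C"
  by (simp add: vec_eq_iff matrix_mul_nth algebra_simps sum_subtractf)

lemma cmat_diff_ldistrib: "C ** ((A - B) :: ('n::finite) cmat) = C ** A - C ** B"
  by (simp add: vec_eq_iff matrix_mul_nth algebra_simps sum_subtractf)

lemma cscale_diff_left: "(a - b) *\<^sub>C A = a *\<^sub>C A - b *\<^sub>C A"
  by (simp add: cscale_def vec_eq_iff algebra_simps)

lemma unitary_adj_mult: "unitary u \<Longrightarrow> unitary v \<Longrightarrow> unitary (adj u ** v)"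
  unfolding unitary_def by (metis adj_adj adj_mult matrix_mul_assoc matrix_mul_rid)

lemma unitary_adj: "unitary u \<Longrightarrow> unitary (adj u)"
  by (simp add: unitary_def)

section \<open>Euclidean norms and the operator norm\<close>

lemma norm_cvec_power2: "(norm (x :: complex ^ 'n))\<^sup>2 = (\<Sum>i\<in>UNIV. (cmod (x $ i))\<^sup>2)"
  by (simp add: norm_vec_def L2_set_def sum_nonneg)

lemma norm_unitary_mult:
  fixes U :: "('n::finite) cmat"
  assumes "unitary U"
  shows "norm (U *v x) = norm x"
proof -
  \<comment> \<open>All columns of \<open>X y\<close> equal \<open>y\<close>, so
    \<open>trace_adj_self\<close> yields n times the squared norm of \<open>y\<close>, and the claim
    becomes a cancellation of \<open>adj U ** U\<close> under the trace.\<close>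
  define X where "(X y :: 'n cmat) = (\<chi> i j. y $ i)" for y :: "complex ^ 'n"
  have tr: "trace (adj (X y) ** X y) = of_real (real CARD('n) * (norm y)\<^sup>2)" for y
    unfolding trace_adj_self norm_cvec_power2 by (simp add: X_def)
  have UX: "X (U *v x) = U ** X x"
    by (simp add: X_def vec_eq_iff matrix_mul_nth matrix_vector_mult_def)
  have "adj (U ** X x) ** (U ** X x) = adj (X x) ** (adj U ** U) ** X x"
    by (simp only: adj_mult matrix_mul_assoc)
  then have "adj (U ** X x) ** (U ** X x) = adj (X x) ** X x"
    using assms by (simp add: unitary_def)
  then have "complex_of_real (real CARD('n) * (norm (U *v x))\<^sup>2) = of_real (real CARD('n) * (norm x)\<^sup>2)"
    by (simp only: UX flip: tr)
  then have "(norm (U *v x))\<^sup>2 = (norm x)\<^sup>2"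
    unfolding of_real_eq_iff by simp
  then show ?thesis by simp
qed

lemma mat_opnorm_nonneg: "mat_opnorm A \<ge> 0"
  unfolding mat_opnorm_def by (rule onorm_pos_le) simp

lemma mat_opnorm_eq_0: "mat_opnorm A = 0 \<longleftrightarrow> A = 0"
proof -
  have "mat_opnorm A = 0 \<longleftrightarrow> (\<forall>x. A *v x = 0)"
    unfolding mat_opnorm_def by (rule onorm_eq_0) simp
  then show ?thesis
    by (metis matrix_eq matrix_vector_mult_0)
qed

lemma mat_opnorm_cscale_id: "mat_opnorm (c *\<^sub>C (mat 1 :: ('n::finite) cmat)) = cmod c"
proof -
  have 1: "(c *\<^sub>C (mat 1 :: 'n cmat)) *v x = c *s x" for x
    by (simp add: vec_eq_iff matrix_vector_mult_def cscale_def mat_def if_distrib if_distribR cong: if_cong)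
  have 2: "norm (c *s x) = cmod c * norm x" for x :: "complex ^ 'n"
  proof -
    have "(norm (c *s x))\<^sup>2 = (cmod c * norm x)\<^sup>2"
      unfolding power_mult_distrib norm_cvec_power2
      by (simp add: norm_mult power_mult_distrib sum_distrib_left)
    then show ?thesis by simp
  qed
  define y :: "complex ^ 'n" where "y = axis undefined 1"
  have "y \<noteq> 0" by (simp add: y_def axis_eq_0_iff)
  show ?thesis
  proof (rule antisym)
    show "mat_opnorm (c *\<^sub>C (mat 1 :: 'n cmat)) \<le> cmod c"
      unfolding mat_opnorm_def by (rule onorm_le) (simp add: 1 2)
    have "norm ((c *\<^sub>C (mat 1 :: 'n cmat)) *v y) / norm y \<le> mat_opnorm (c *\<^sub>C (mat 1 :: 'n cmat))"
      unfolding mat_opnorm_def by (rule le_onorm) simp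
    then show "cmod c \<le> mat_opnorm (c *\<^sub>C (mat 1 :: 'n cmat))"
      using \<open>y \<noteq> 0\<close> by (simp add: 1 2)
  qed
qed

section \<open>The dual conditional expectation\<close>

lemma is_dual_cond_exp_dual_cond_exp: "is_dual_cond_exp dual_cond_exp"
  unfolding dual_cond_exp_def by (rule theI'[OF dual_cond_exp_ex1])

lemma op_clinear_sandwich: "op_clinear (\<lambda>X. A ** X ** B)"
  by (simp add: op_clinear_def matrix_add_ldistrib cmat_add_rdistrib)

text \<open>Expanding X in matrix units turns the operator into a sum of operators x e_1 y, on which
  the dual conditional expectation is prescribed. This is the tensor formula, with the second tensor
  factor being the transpose of \<open>B\<close>.\<close>

lemma dual_cond_exp_sandwich:
  fixes A B :: "('n::finite) cmat"
  shows "dual_cond_exp (\<lambda>X. A ** X ** B) = (trace B / of_nat CARD('n)) *\<^sub>C A"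
proof -
  let ?n = "of_nat CARD('n) :: complex"
  define R where "R i j X = (A ** mat_unit i j ** B) ** e1 ((?n *\<^sub>C mat_unit j i) ** X)"
    for i j :: 'n and X :: "'n cmat"
  have R: "op_clinear (R i j)" for i j
    unfolding R_def by (rule op_clinear_rank_one)
  have sandwich: "(\<lambda>X. A ** X ** B) = (\<lambda>X. \<Sum>i\<in>UNIV. \<Sum>j\<in>UNIV. R i j X)"
  proof
    fix X
    have "A ** X ** B = A ** (\<Sum>i\<in>UNIV. \<Sum>j\<in>UNIV. X $ i $ j *\<^sub>C mat_unit i j) ** B"
      by (simp flip: mat_unit_expand)
    also have "\<dots> = (\<Sum>i\<in>UNIV. \<Sum>j\<in>UNIV. R i j X)"
      by (simp add: cmat_mult_sum cmat_sum_mult R_def e1_eq trace_mat_unit_mult)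
    finally show "A ** X ** B = (\<Sum>i\<in>UNIV. \<Sum>j\<in>UNIV. R i j X)" .
  qed
  \<comment> \<open>Since E_ij B E_ji = B_jj E_ii, summing over j produces the trace of
    \<open>B\<close>, and summing over i the identity.\<close>
  have E_R: "dual_cond_exp (R i j) = (B $ j $ j / ?n) *\<^sub>C (A ** mat_unit i i)" for i j
  proof -
    have "dual_cond_exp (R i j) = (1 / ?n\<^sup>2) *\<^sub>C ((A ** mat_unit i j ** B) ** (?n *\<^sub>C mat_unit j i))"
      using is_dual_cond_exp_dual_cond_exp unfolding R_def is_dual_cond_exp_def by blast
    also have "(A ** mat_unit i j ** B) ** (?n *\<^sub>C mat_unit j i)
        = ?n *\<^sub>C (A ** (mat_unit i j ** B ** mat_unit j i))"
      by (simp add: matrix_mul_assoc)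
    also have "\<dots> = (?n * B $ j $ j) *\<^sub>C (A ** mat_unit i i)"
      by (simp add: mat_unit_sandwich)
    finally show ?thesis by (simp add: power2_eq_square)
  qed
  have inner: "op_clinear (\<lambda>X. \<Sum>j\<in>UNIV. R i j X) \<and>
      dual_cond_exp (\<lambda>X. \<Sum>j\<in>UNIV. R i j X) = (\<Sum>j\<in>UNIV. dual_cond_exp (R i j))" for i
    by (rule is_dual_cond_exp_sum[OF is_dual_cond_exp_dual_cond_exp]) (simp_all add: R)
  have "dual_cond_exp (\<lambda>X. A ** X ** B) = (\<Sum>i\<in>UNIV. \<Sum>j\<in>UNIV. dual_cond_exp (R i j))"
    unfolding sandwich
    by (subst is_dual_cond_exp_sum[OF is_dual_cond_exp_dual_cond_exp, THEN conjunct2])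
      (simp_all add: inner)
  also have "\<dots> = (\<Sum>i\<in>UNIV. (trace B / ?n) *\<^sub>C (A ** mat_unit i i))"
    by (intro sum.cong refl)
      (simp add: E_R trace_def sum_divide_distrib cscale_def vec_eq_iff sum_distrib_right)
  also have "\<dots> = (trace B / ?n) *\<^sub>C A"
    by (simp add: sum_mat_unit_diag flip: cscale_sum cmat_mult_sum)
  finally show ?thesis .
qed

lemma dual_cond_exp_e1:
  "dual_cond_exp (e1 :: ('n::finite) cmat \<Rightarrow> 'n cmat) = (1 / (of_nat CARD('n))\<^sup>2) *\<^sub>C mat 1"
proof -
  have "dual_cond_exp (\<lambda>X. mat 1 ** e1 (mat 1 ** X))
      = (1 / (of_nat CARD('n))\<^sup>2) *\<^sub>C (mat 1 ** mat 1 :: 'n cmat)"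
    using is_dual_cond_exp_dual_cond_exp unfolding is_dual_cond_exp_def by blast
  then show ?thesis by simp
qed

lemma op_clinear_e1: "op_clinear e1"
  using op_clinear_rank_one[of "mat 1" "mat 1"] by simp

lemma dual_cond_exp_diff:
  assumes "op_clinear S" "op_clinear T"
  shows "dual_cond_exp (\<lambda>X. S X - T X) = dual_cond_exp S - dual_cond_exp T"
proof -
  have minus: "A - B = A + (-1) *\<^sub>C B" for A B :: "'a cmat"
    by (simp add: cscale_def vec_eq_iff)
  have "op_clinear (\<lambda>X. (-1) *\<^sub>C T X)"
    using assms(2) by (auto simp: op_clinear_def cscale_add algebra_simps)
  then show ?thesis
    using is_dual_cond_exp_dual_cond_exp assms
    unfolding is_dual_cond_exp_def minus by metis
qed

section \<open>Adjoints of reduced Jones projections\<close>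

text \<open>Uniqueness comes from definiteness of \<open>inner_tau\<close>: testing two candidates
  against their own difference forces it to vanish.\<close>

lemma op_adj_eqI:
  fixes S :: "('n::finite) cmat \<Rightarrow> 'n cmat"
  assumes "\<And>X Y. inner_tau (T X) Y = inner_tau X (S Y)"
  shows "op_adj S = T"
  unfolding op_adj_def
proof (rule the_equality)
  fix T' assume T': "\<forall>X Y. inner_tau (T' X) Y = inner_tau X (S Y)"
  show "T' = T"
  proof
    fix X
    have "inner_tau (T' X) (T' X - T X) = inner_tau (T X) (T' X - T X)"
      using T' assms by simp
    then have "trace (adj (T' X - T X) ** (T' X - T X)) = 0"
      by (simp add: inner_tau_def adj_diff cmat_diff_rdistrib trace_sub)
    then show "T' X = T X" by (simp add: trace_adj_self_eq_0)
  qed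
qed (use assms in blast)

text \<open>For unitary \<open>U\<close> these are the minimal projections of
  \<open>conj_set U diagonals\<close>, onto the lines spanned by the columns of
  \<open>U\<close>.\<close>

definition axis_proj :: "('n::finite) cmat \<Rightarrow> 'n \<Rightarrow> 'n cmat" where
  "axis_proj U k = U ** mat_unit k k ** adj U"

lemma adj_axis_proj: "adj (axis_proj U k) = axis_proj U k"
  by (simp add: axis_proj_def adj_mult adj_mat_unit matrix_mul_assoc)

text \<open>Taking the diagonal part is pinching by the diagonal matrix units. The sum of two-sided
  multiplications is the form that \<open>dual_cond_exp_sandwich\<close> can evaluate.\<close>

lemma jones_conj_diagonals_sum:
  assumes "unitary U"
  shows "jones (conj_set U diagonals) X = (\<Sum>k\<in>UNIV. axis_proj U k ** X ** axis_proj U k)"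
proof -
  have "(\<chi> i j. if i = j then Y $ i $ j else 0)
      = (\<Sum>k\<in>UNIV. mat_unit k k ** Y ** mat_unit k k)" for Y :: "'a cmat"
    by (auto simp: vec_eq_iff mult_mat_unit mat_unit_mult intro!: sum.neutral)
  then show ?thesis
    by (simp add: jones_conj_diagonals[OF assms] cmat_mult_sum cmat_sum_mult axis_proj_def
        matrix_mul_assoc)
qed

lemma inner_tau_diff_left: "inner_tau (A - B) C = inner_tau A C - inner_tau B C"
  by (simp add: inner_tau_def adj_diff cmat_diff_rdistrib trace_sub diff_divide_distrib)

lemma inner_tau_diff_right: "inner_tau A (B - C) = inner_tau A B - inner_tau A C"
  by (simp add: inner_tau_def cmat_diff_ldistrib trace_sub diff_divide_distrib)

text \<open>The projections \<open>axis_proj U k\<close> are self-adjoint, so cyclicity of the trace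
  moves each two-sided multiplication across \<open>inner_tau\<close>; for \<open>e1\<close> the
  explicit formula suffices.\<close>

lemma op_adj_reduced_jones:
  fixes U :: "('n::finite) cmat"
  assumes "unitary U"
  shows "op_adj (reduced_jones (conj_set U diagonals)) = reduced_jones (conj_set U diagonals)"
proof (rule op_adj_eqI)
  fix X Y :: "'n cmat"
  have "trace (adj (q ** X ** q) ** Y) = trace (adj X ** (q ** Y ** q))" if "adj q = q" for q
  proof -
    have "trace (adj (q ** X ** q) ** Y) = trace (q ** (adj X ** q ** Y))"
      by (simp add: adj_mult that matrix_mul_assoc)
    also have "\<dots> = trace (adj X ** q ** Y ** q)"
      by (rule trace_mul_sym)
    finally show ?thesis by (simp add: matrix_mul_assoc)
  qed
  then have "inner_tau (jones (conj_set U diagonals) X) Y = inner_tau X (jones (conj_set U diagonals) Y)"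
    by (simp add: inner_tau_def jones_conj_diagonals_sum[OF assms] adj_sum cmat_sum_mult
        cmat_mult_sum trace_sum adj_axis_proj)
  moreover have "adj (mat 1 :: 'n cmat) = mat 1"
    by (simp add: adj_def mat_def vec_eq_iff)
  then have "inner_tau (e1 X) Y = inner_tau X (e1 Y)"
    by (simp add: inner_tau_def e1_eq adj_cscale trace_adj)
  ultimately show "inner_tau (reduced_jones (conj_set U diagonals) X) Y
      = inner_tau X (reduced_jones (conj_set U diagonals) Y)"
    by (simp add: reduced_jones_def inner_tau_diff_left inner_tau_diff_right)
qed

section \<open>The mixed second moment of two reduced Jones projections\<close>

definition moment_mat :: "('n::finite) cmat \<Rightarrow> 'n cmat" where
  "moment_mat W = (\<chi> k l. of_real ((cmod (W $ k $ l))\<^sup>2 - 1 / real CARD('n)) * W $ k $ l)"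

text \<open>The expectation preserves the trace and fixes the scalars, so \<open>e1\<close> absorbs
  it on either side. This collapses the product of two reduced projections.\<close>

lemma e1_jones_conj_diagonals:
  assumes "unitary U"
  shows "e1 (jones (conj_set U diagonals) X) = e1 X" "jones (conj_set U diagonals) (e1 X) = e1 X"
proof -
  define D where "D Y = (\<chi> i j. if i = j then Y $ i $ j else 0)" for Y :: "'a cmat"
  have U: "adj U ** U = mat 1" "U ** adj U = mat 1"
    using assms by (auto simp: unitary_def)
  have J: "jones (conj_set U diagonals) X = U ** D (adj U ** X ** U) ** adj U" for X
    unfolding D_def by (rule jones_conj_diagonals[OF assms])
  have "trace (jones (conj_set U diagonals) X) = trace (adj U ** (U ** D (adj U ** X ** U)))"
    unfolding J by (rule trace_mul_sym)
  also have "\<dots> = trace (adj U ** X ** U)"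
    by (simp add: matrix_mul_assoc U) (simp add: D_def trace_def)
  also have "\<dots> = trace (U ** (adj U ** X))"
    by (rule trace_mul_sym)
  also have "\<dots> = trace X"
    by (simp add: matrix_mul_assoc U)
  finally show "e1 (jones (conj_set U diagonals) X) = e1 X"
    by (simp add: e1_eq)
  have "D (c *\<^sub>C mat 1) = c *\<^sub>C mat 1" for c
    by (auto simp: D_def cscale_def mat_def vec_eq_iff)
  then show "jones (conj_set U diagonals) (e1 X) = e1 X"
    by (simp add: J e1_eq U)
qed

lemma op_inner_reduced_jones:
  fixes u v :: "('n::finite) cmat"
  assumes u: "unitary u" and v: "unitary v"
  shows "op_inner (reduced_jones (conj_set u diagonals)) (reduced_jones (conj_set v diagonals))
      = (1 / of_nat CARD('n)) *\<^sub>C (u ** moment_mat (adj u ** v) ** adj v)"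
proof -
  let ?n = "of_nat CARD('n) :: complex"
  let ?Ju = "jones (conj_set u diagonals)" and ?Jv = "jones (conj_set v diagonals)"
  define W where "W = adj u ** v"
  \<comment> \<open>Both parts of the moment are expanded over the same matrices
    \<open>F k l\<close>, so that they can be subtracted coefficient by coefficient.\<close>
  define F where "F k l = u ** mat_unit k l ** adj v" for k l
  define S where "S = (\<lambda>(k, l) X. (axis_proj u k ** axis_proj v l) ** X ** (axis_proj v l ** axis_proj u k))"
  have Ju_diff: "?Ju (X - Y) = ?Ju X - ?Ju Y" for X Y
    by (simp add: jones_conj_diagonals_sum[OF u] cmat_diff_ldistrib cmat_diff_rdistrib sum_subtractf)
  have e1_diff: "e1 (X - Y) = e1 X - e1 Y" for X Y :: "'n cmat"
    by (simp add: e1_eq trace_sub diff_divide_distrib cscale_diff_left)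
  have e1_e1: "e1 (e1 X) = e1 X" for X :: "'n cmat"
    by (simp add: e1_eq) (simp add: trace_def mat_def)
  have S_lin: "op_clinear (S kl)" for kl
    unfolding S_def case_prod_beta by (rule op_clinear_sandwich)
  \<comment> \<open>By self-adjointness and absorption, the three terms of the product that contain
    \<open>e1\<close> add up to minus \<open>e1\<close>.\<close>
  have "op_adj (reduced_jones (conj_set u diagonals)) \<circ> reduced_jones (conj_set v diagonals)
      = (\<lambda>X. ?Ju (?Jv X) - e1 X)"
    by (subst op_adj_reduced_jones[OF u])
      (simp add: fun_eq_iff reduced_jones_def Ju_diff e1_diff
        e1_jones_conj_diagonals u v e1_e1)
  also have "\<dots> = (\<lambda>X. (\<Sum>kl\<in>UNIV. S kl X) - e1 X)"
    by (simp add: fun_eq_iff jones_conj_diagonals_sum u v S_def cmat_sum_mult cmat_mult_sum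
        matrix_mul_assoc sum.cartesian_product case_prod_beta)
  finally have "op_inner (reduced_jones (conj_set u diagonals)) (reduced_jones (conj_set v diagonals))
      = dual_cond_exp (\<lambda>X. (\<Sum>kl\<in>UNIV. S kl X) - e1 X)"
    by (simp add: op_inner_def)
  also have "\<dots> = (\<Sum>kl\<in>UNIV. dual_cond_exp (S kl)) - (1 / ?n\<^sup>2) *\<^sub>C mat 1"
    using is_dual_cond_exp_sum[OF is_dual_cond_exp_dual_cond_exp, of UNIV S] S_lin
    by (simp add: dual_cond_exp_diff op_clinear_e1 dual_cond_exp_e1)
  also have "(\<Sum>kl\<in>UNIV. dual_cond_exp (S kl))
      = (\<Sum>k\<in>UNIV. \<Sum>l\<in>UNIV. (of_real ((cmod (W $ k $ l))\<^sup>2) * W $ k $ l / ?n) *\<^sub>C F k l)"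
  proof -
    have prod: "axis_proj u k ** axis_proj v l = W $ k $ l *\<^sub>C F k l" for k l
    proof -
      have "axis_proj u k ** axis_proj v l = u ** (mat_unit k k ** W ** mat_unit l l) ** adj v"
        by (simp add: axis_proj_def W_def matrix_mul_assoc)
      then show ?thesis
        by (simp add: mat_unit_sandwich F_def)
    qed
    \<comment> \<open>Reversing the product keeps the trace. One factor \<open>W $ k $ l\<close>
      comes from \<open>prod\<close>, its conjugate from the trace of \<open>F k l\<close>.\<close>
    have tr: "trace (axis_proj v l ** axis_proj u k) = of_real ((cmod (W $ k $ l))\<^sup>2)" for k l
    proof -
      have "trace (axis_proj v l ** axis_proj u k) = W $ k $ l * trace (u ** (mat_unit k l ** adj v))"
        by (subst trace_mul_sym) (simp add: prod F_def matrix_mul_assoc)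
      also have "trace (u ** (mat_unit k l ** adj v)) = trace (mat_unit k l ** (adj v ** u))"
        by (subst trace_mul_sym) (simp add: matrix_mul_assoc)
      also have "adj v ** u = adj W"
        by (simp add: W_def adj_mult)
      finally show ?thesis
        by (simp only: trace_mat_unit_mult complex_norm_square) (simp add: adj_def)
    qed
    have "dual_cond_exp (S (k, l)) = (of_real ((cmod (W $ k $ l))\<^sup>2) * W $ k $ l / ?n) *\<^sub>C F k l" for k l
      by (simp only: S_def prod.case dual_cond_exp_sandwich tr prod cscale_cscale)
        (simp add: mult.commute)
    then show ?thesis
      unfolding sum.cartesian_product by (intro sum.cong) auto
  qed
  \<comment> \<open>As the identity is \<open>u ** W ** adj v\<close>, the contribution of
    \<open>e1\<close> has coefficients proportional to the entries of \<open>W\<close>.\<close>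
  also have "(1 / ?n\<^sup>2) *\<^sub>C mat 1 = (\<Sum>k\<in>UNIV. \<Sum>l\<in>UNIV. (W $ k $ l / ?n\<^sup>2) *\<^sub>C F k l)"
  proof -
    have "mat 1 = u ** W ** adj v"
      using u v by (metis W_def matrix_mul_assoc matrix_mul_rid unitary_def)
    also have "\<dots> = u ** (\<Sum>k\<in>UNIV. \<Sum>l\<in>UNIV. W $ k $ l *\<^sub>C mat_unit k l) ** adj v"
      by (simp flip: mat_unit_expand)
    also have "\<dots> = (\<Sum>k\<in>UNIV. \<Sum>l\<in>UNIV. W $ k $ l *\<^sub>C F k l)"
      by (simp add: cmat_mult_sum cmat_sum_mult F_def)
    finally show ?thesis by (simp add: cscale_sum)
  qed
  also have "(\<Sum>k\<in>UNIV. \<Sum>l\<in>UNIV. (of_real ((cmod (W $ k $ l))\<^sup>2) * W $ k $ l / ?n) *\<^sub>C F k l)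
        - (\<Sum>k\<in>UNIV. \<Sum>l\<in>UNIV. (W $ k $ l / ?n\<^sup>2) *\<^sub>C F k l)
      = (\<Sum>k\<in>UNIV. \<Sum>l\<in>UNIV. (1 / ?n) *\<^sub>C (moment_mat W $ k $ l *\<^sub>C F k l))"
    by (simp add: moment_mat_def power2_eq_square algebra_simps diff_divide_distrib
        flip: sum_subtractf cscale_diff_left)
  also have "\<dots> = (1 / ?n) *\<^sub>C (u ** (\<Sum>k\<in>UNIV. \<Sum>l\<in>UNIV. moment_mat W $ k $ l *\<^sub>C mat_unit k l) ** adj v)"
    by (simp add: F_def cmat_mult_sum cmat_sum_mult cscale_sum)
  finally show ?thesis
    by (simp add: W_def flip: mat_unit_expand)
qed

text \<open>This is the mixed moment with both unitaries equal: \<open>W\<close> is then the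
  identity, whose moment matrix is the scalar 1 - 1/n.\<close>

lemma op_norm_reduced_jones:
  fixes u :: "('n::finite) cmat"
  assumes u: "unitary u"
  shows "op_norm (reduced_jones (conj_set u diagonals))
      = sqrt ((1 - 1 / real CARD('n)) / real CARD('n))"
proof -
  let ?n = "of_nat CARD('n) :: complex"
  have "moment_mat (mat 1 :: 'n cmat) = (1 - 1 / ?n) *\<^sub>C mat 1"
    by (simp add: moment_mat_def vec_eq_iff cscale_def mat_def)
  then have "(1 / ?n) *\<^sub>C (u ** moment_mat (adj u ** u) ** adj u)
      = ((1 - 1 / ?n) / ?n) *\<^sub>C mat 1"
    using u by (simp add: unitary_def)
  also have "(1 - 1 / ?n) / ?n = of_real ((1 - 1 / real CARD('n)) / real CARD('n))"
    by simp
  finally have "op_norm (reduced_jones (conj_set u diagonals))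
      = sqrt (cmod (of_real ((1 - 1 / real CARD('n)) / real CARD('n))))"
    unfolding op_norm_def op_inner_def[symmetric] op_inner_reduced_jones[OF u u]
    by (simp only: mat_opnorm_cscale_id)
  moreover have "real CARD('n) \<ge> 1"
    by (simp add: Suc_le_eq)
  ultimately show ?thesis
    by (simp only: norm_of_real) (simp add: field_simps)
qed

section \<open>Vanishing of the moment matrix and the Hadamard condition\<close>

lemma unitary_sum_cmod2:
  assumes "unitary W"
  shows "(\<Sum>k\<in>UNIV. (cmod (W $ k $ l))\<^sup>2) = 1" "(\<Sum>l\<in>UNIV. (cmod (W $ k $ l))\<^sup>2) = 1"
proof -
  have col: "(\<Sum>k\<in>UNIV. (cmod (V $ k $ l))\<^sup>2) = 1" if "unitary V" for V :: "'a cmat" and l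
  proof -
    have "complex_of_real (\<Sum>k\<in>UNIV. (cmod (V $ k $ l))\<^sup>2) = (adj V ** V) $ l $ l"
      unfolding matrix_mul_nth of_real_sum
      by (intro sum.cong refl) (simp only: complex_norm_square, simp add: adj_def mult.commute)
    also have "\<dots> = 1"
      using that by (simp add: unitary_def mat_def)
    finally show ?thesis by (simp only: of_real_eq_1_iff)
  qed
  show "(\<Sum>k\<in>UNIV. (cmod (W $ k $ l))\<^sup>2) = 1"
    by (rule col[OF assms])
  show "(\<Sum>l\<in>UNIV. (cmod (W $ k $ l))\<^sup>2) = 1"
    using col[OF unitary_adj[OF assms], of k] by (simp add: adj_def)
qed

lemma moment_mat_eq_0_iff:
  fixes W :: "('n::finite) cmat"
  assumes "unitary W"
  shows "moment_mat W = 0 \<longleftrightarrow> hadamard_unitary W"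
proof
  let ?n = "real CARD('n)"
  assume "moment_mat W = 0"
  then have "moment_mat W $ k $ l = 0" for k l by simp
  then have "of_real ((cmod (W $ k $ l))\<^sup>2 - 1 / ?n) * W $ k $ l = 0" for k l
    by (simp add: moment_mat_def)
  then have or: "W $ k $ l = 0 \<or> (cmod (W $ k $ l))\<^sup>2 = 1 / ?n" for k l
    by (metis mult_eq_0_iff of_real_eq_0_iff right_minus_eq)
  have "(cmod (W $ k $ l))\<^sup>2 = 1 / ?n" for k l
  proof -
    \<comment> \<open>Each deviation is 0 or 1/n, hence nonnegative; since a row sums to 0, all of
      its deviations vanish.\<close>
    have "(\<Sum>l\<in>UNIV. 1 / ?n - (cmod (W $ k $ l))\<^sup>2) = 0"
      by (simp add: sum_subtractf unitary_sum_cmod2[OF assms])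
    moreover have "1 / ?n - (cmod (W $ k $ l))\<^sup>2 \<ge> 0" for l
      using or[of k l] by auto
    ultimately show ?thesis
      by (subst (asm) sum_nonneg_eq_0_iff) auto
  qed
  then show "hadamard_unitary W"
    using assms unfolding hadamard_unitary_def
    by (metis norm_ge_zero real_sqrt_divide real_sqrt_one real_sqrt_unique)
next
  assume "hadamard_unitary W"
  then show "moment_mat W = 0"
    by (simp add: hadamard_unitary_def moment_mat_def vec_eq_iff power_divide)
qed

section \<open>The norm bound for the moment matrix\<close>

text \<open>The entry \<open>z k\<close> is minus the sum of the n - 1 others, so Cauchy-Schwarz
  bounds its square by n - 1 times the rest of the square sum. Adding (n - 1) times the square
  itself completes that sum.\<close>

lemma cmod2_le_of_sum_eq_0:
  fixes z :: "'n::finite \<Rightarrow> complex"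
  assumes "(\<Sum>i\<in>UNIV. z i) = 0"
  shows "(cmod (z k))\<^sup>2 \<le> (1 - 1 / real CARD('n)) * (\<Sum>i\<in>UNIV. (cmod (z i))\<^sup>2)"
proof -
  let ?n = "real CARD('n)" and ?A = "UNIV - {k}"
  have n: "?n \<ge> 1" by (simp add: Suc_le_eq)
  have "z k = - (\<Sum>i\<in>?A. z i)"
    using assms by (simp add: sum.remove[of UNIV k] eq_neg_iff_add_eq_0)
  then have "cmod (z k) \<le> (\<Sum>i\<in>?A. 1 * cmod (z i))"
    by (simp add: norm_sum)
  then have "(cmod (z k))\<^sup>2 \<le> (\<Sum>i\<in>?A. 1 * cmod (z i))\<^sup>2"
    by (simp add: power_mono)
  also have "\<dots> \<le> (\<Sum>i\<in>?A. 1\<^sup>2) * (\<Sum>i\<in>?A. (cmod (z i))\<^sup>2)"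
    by (rule Cauchy_Schwarz_ineq_sum)
  also have "(\<Sum>i\<in>?A. 1\<^sup>2 :: real) = ?n - 1"
    using n by (simp add: of_nat_diff)
  finally have "?n * (cmod (z k))\<^sup>2 \<le> (?n - 1) * ((cmod (z k))\<^sup>2 + (\<Sum>i\<in>?A. (cmod (z i))\<^sup>2))"
    by (simp add: algebra_simps)
  also have "(cmod (z k))\<^sup>2 + (\<Sum>i\<in>?A. (cmod (z i))\<^sup>2) = (\<Sum>i\<in>UNIV. (cmod (z i))\<^sup>2)"
    by (simp add: sum.remove[of UNIV k])
  finally show ?thesis
    using n by (simp add: field_simps)
qed

text \<open>
  With \<open>b i l = |W i l|\<^sup>2 - 1/n\<close> and \<open>z i = W (b i \<cdot> y)\<close>, the vectors \<open>z i\<close> sum to zero and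
  the \<open>k\<close>-th entry of \<open>moment_mat W y\<close> is the \<open>k\<close>-th entry of \<open>z k\<close>.
\<close>
lemma norm_moment_mat_le:
  fixes W :: "('n::finite) cmat"
  assumes "unitary W"
  shows "norm (moment_mat W *v y) \<le> (1 - 1 / real CARD('n)) * norm y"
proof -
  define c where "c = 1 - 1 / real CARD('n)"
  define b where "b i l = (cmod (W $ i $ l))\<^sup>2 - 1 / real CARD('n)" for i l
  define By where "By i = (\<chi> l. of_real (b i l) * y $ l)" for i
  define z where "z i = W *v By i" for i
  have c0: "c \<ge> 0" by (simp add: c_def Suc_le_eq)
  have sum_b: "(\<Sum>i\<in>UNIV. b i l) = 0" for l
    by (simp add: b_def sum_subtractf unitary_sum_cmod2[OF assms])
  have entry: "(moment_mat W *v y) $ k = z k $ k" for k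
    by (simp add: z_def By_def b_def matrix_vector_mult_def moment_mat_def mult_ac)
  have sum_z: "(\<Sum>i\<in>UNIV. z i $ k) = 0" for k
  proof -
    have "(\<Sum>i\<in>UNIV. z i $ k) = (\<Sum>l\<in>UNIV. \<Sum>i\<in>UNIV. W $ k $ l * (of_real (b i l) * y $ l))"
      by (subst sum.swap) (simp add: z_def By_def matrix_vector_mult_def)
    also have "\<dots> = (\<Sum>l\<in>UNIV. W $ k $ l * (of_real (\<Sum>i\<in>UNIV. b i l) * y $ l))"
      by (simp add: sum_distrib_left sum_distrib_right)
    finally show ?thesis by (simp add: sum_b)
  qed
  \<comment> \<open>As \<open>b\<close> sums to zero over \<open>i\<close>, one factor
    \<open>b i l\<close> may be replaced by the squared modulus of \<open>W $ i $ l\<close>. This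
    leaves a weighted mean of \<open>b\<close> with weights summing to 1, and \<open>b\<close> is at
    most \<open>c\<close>.\<close>
  have sum_b2: "(\<Sum>i\<in>UNIV. (b i l)\<^sup>2) \<le> c" for l
  proof -
    let ?p = "\<lambda>i. (cmod (W $ i $ l))\<^sup>2"
    have p1: "?p i \<le> 1" for i
      using member_le_sum[of i UNIV ?p] unitary_sum_cmod2(1)[OF assms, of l] by simp
    have "(\<Sum>i\<in>UNIV. (b i l)\<^sup>2) = (\<Sum>i\<in>UNIV. ?p i * b i l)"
    proof -
      have "(\<Sum>i\<in>UNIV. (b i l)\<^sup>2) = (\<Sum>i\<in>UNIV. ?p i * b i l - 1 / real CARD('n) * b i l)"
        by (simp add: b_def power2_eq_square algebra_simps)
      then show ?thesis
        by (simp only: sum_subtractf sum_b mult_zero_right diff_zero flip: sum_distrib_left)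
    qed
    also have "\<dots> \<le> (\<Sum>i\<in>UNIV. ?p i * c)"
      using p1 by (intro sum_mono mult_left_mono) (auto simp: b_def c_def)
    also have "\<dots> = c"
      by (simp add: unitary_sum_cmod2[OF assms] flip: sum_distrib_right)
    finally show ?thesis .
  qed
  have "(norm (moment_mat W *v y))\<^sup>2 = (\<Sum>k\<in>UNIV. (cmod (z k $ k))\<^sup>2)"
    by (simp add: norm_cvec_power2 entry)
  \<comment> \<open>The zero sum of the \<open>z i\<close> gives one factor \<open>c\<close>; after
    unitarity removes \<open>W\<close>, \<open>sum_b2\<close> gives the second, as needed for the
    square of \<open>c * norm y\<close>.\<close>
  also have "\<dots> \<le> (\<Sum>k\<in>UNIV. c * (\<Sum>i\<in>UNIV. (cmod (z i $ k))\<^sup>2))"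
    unfolding c_def by (intro sum_mono cmod2_le_of_sum_eq_0 sum_z)
  also have "\<dots> = c * (\<Sum>i\<in>UNIV. (norm (z i))\<^sup>2)"
    unfolding norm_cvec_power2 by (simp only: sum_distrib_left) (rule sum.swap)
  also have "(\<Sum>i\<in>UNIV. (norm (z i))\<^sup>2) = (\<Sum>i\<in>UNIV. (norm (By i))\<^sup>2)"
    by (simp add: z_def norm_unitary_mult[OF assms])
  also have "\<dots> = (\<Sum>l\<in>UNIV. (\<Sum>i\<in>UNIV. (b i l)\<^sup>2) * (cmod (y $ l))\<^sup>2)"
    unfolding norm_cvec_power2
    by (subst sum.swap) (simp add: By_def norm_mult power_mult_distrib sum_distrib_right)
  also have "c * \<dots> \<le> c * (\<Sum>l\<in>UNIV. c * (cmod (y $ l))\<^sup>2)"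
    using c0 by (intro mult_left_mono sum_mono mult_right_mono sum_b2) auto
  also have "\<dots> = (c * norm y)\<^sup>2"
    by (simp only: norm_cvec_power2 power_mult_distrib flip: sum_distrib_left)
      (simp only: power2_eq_square mult.assoc)
  finally show ?thesis
    unfolding c_def[symmetric] by (rule power2_le_imp_le) (simp add: c0)
qed

text \<open>The outer unitaries are isometries, so the bound on the moment matrix carries over. The
  right-hand side is the product of the two norms in the denominator of the cosine.\<close>

lemma mat_opnorm_op_inner_le:
  fixes u v :: "('n::finite) cmat"
  assumes u: "unitary u" and v: "unitary v"
  shows "mat_opnorm (op_inner (reduced_jones (conj_set u diagonals)) (reduced_jones (conj_set v diagonals)))
      \<le> (1 - 1 / real CARD('n)) / real CARD('n)"
  unfolding mat_opnorm_def op_inner_reduced_jones[OF assms]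
proof (rule onorm_le)
  fix x :: "complex ^ 'n"
  let ?M = "moment_mat (adj u ** v)" and ?n = "real CARD('n)"
  have "((1 / of_nat CARD('n)) *\<^sub>C A) *v x = (1 / ?n) *\<^sub>R (A *v x)" for A :: "'n cmat"
    by (simp add: cscale_def vec_eq_iff matrix_vector_mult_def sum_divide_distrib)
      (simp add: scaleR_conv_of_real sum_divide_distrib)
  then have "norm (((1 / of_nat CARD('n)) *\<^sub>C (u ** ?M ** adj v)) *v x)
      = norm (u *v (?M *v (adj v *v x))) / ?n"
    by (simp add: matrix_vector_mul_assoc matrix_mul_assoc)
  also have "\<dots> \<le> (1 - 1 / ?n) * norm (adj v *v x) / ?n"
    unfolding norm_unitary_mult[OF u]
    by (intro divide_right_mono norm_moment_mat_le unitary_adj_mult assms) simp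
  finally show "norm (((1 / of_nat CARD('n)) *\<^sub>C (u ** ?M ** adj v)) *v x)
      \<le> (1 - 1 / ?n) / ?n * norm x"
    by (simp add: norm_unitary_mult[OF unitary_adj[OF v]])
qed

section \<open>Reading off the angle\<close>

theorem theoremF:
  fixes u v :: "complex ^ 'n ^ 'n"
  assumes "CARD('n) \<ge> 2"
    and "unitary u" and "unitary v"
  shows "interior_angle (conj_set u diagonals) (conj_set v diagonals) = pi / 2
           \<longleftrightarrow> hadamard_unitary (adj u ** v)"
proof -
  let ?n = "real CARD('n)" and ?W = "adj u ** v"
  define N where "N = op_inner (reduced_jones (conj_set u diagonals)) (reduced_jones (conj_set v diagonals))"
  \<comment> \<open>Product of the two equal square roots from \<open>op_norm_reduced_jones\<close>;
    it is positive because n is at least 2.\<close>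
  define c where "c = (1 - 1 / ?n) / ?n"
  define \<rho> where "\<rho> = mat_opnorm N / c"
  have c: "c > 0"
    using assms(1) by (simp add: c_def)
  \<comment> \<open>These bounds make \<open>arccos\<close> a genuine solution in the interval, so
    the definite description denotes.\<close>
  have \<rho>: "0 \<le> \<rho>" "\<rho> \<le> 1"
    using mat_opnorm_op_inner_le[OF assms(2,3)] mat_opnorm_nonneg[of N] c
    by (simp_all add: \<rho>_def N_def c_def[symmetric])
  have "interior_angle (conj_set u diagonals) (conj_set v diagonals)
      = (THE \<alpha>. \<alpha> \<in> {0..pi/2} \<and> cos \<alpha> = \<rho>)"
    using c by (simp add: interior_angle_def op_norm_reduced_jones assms(2,3) \<rho>_def N_def
        flip: c_def)
  also have "\<dots> = arccos \<rho>"
  proof (rule the_equality)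
    show "arccos \<rho> \<in> {0..pi/2} \<and> cos (arccos \<rho>) = \<rho>"
      using \<rho> arccos_le_pi2[of \<rho>] arccos_lbound[of \<rho>] by simp
  next
    fix \<alpha> assume "\<alpha> \<in> {0..pi/2} \<and> cos \<alpha> = \<rho>"
    then show "\<alpha> = arccos \<rho>"
      using arccos_cos[of \<alpha>] pi_gt_zero by auto
  qed
  finally have "interior_angle (conj_set u diagonals) (conj_set v diagonals) = arccos \<rho>" .
  moreover have "arccos \<rho> = pi / 2 \<longleftrightarrow> \<rho> = 0"
    using \<rho> by (metis arccos_0 arccos_eq_iff abs_of_nonneg abs_zero zero_le_one)
  moreover have "\<rho> = 0 \<longleftrightarrow> N = 0"
    using c by (simp add: \<rho>_def mat_opnorm_eq_0)
  moreover have "N = 0 \<longleftrightarrow> moment_mat ?W = 0"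
  proof
    assume "N = 0"
    \<comment> \<open>Clearing 1/n and multiplying by \<open>adj u\<close> and \<open>v\<close> on
      the outside recovers the moment matrix from \<open>N\<close>.\<close>
    have "of_nat CARD('n) *\<^sub>C N = u ** moment_mat ?W ** adj v"
      by (simp add: N_def op_inner_reduced_jones[OF assms(2,3)])
    then have "adj u ** (of_nat CARD('n) *\<^sub>C N) ** v = (adj u ** u) ** moment_mat ?W ** (adj v ** v)"
      by (simp only: matrix_mul_assoc)
    also have "\<dots> = moment_mat ?W"
      using assms(2,3) by (simp add: unitary_def)
    finally show "moment_mat ?W = 0"
      using \<open>N = 0\<close> by (simp add: vec_eq_iff matrix_mul_nth cscale_def)
  qed (simp add: N_def op_inner_reduced_jones[OF assms(2,3)] vec_eq_iff matrix_mul_nth cscale_def)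
  ultimately show ?thesis
    using moment_mat_eq_0_iff[OF unitary_adj_mult[OF assms(2,3)]] by simp
qed

end
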